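(* Let $L$ be a complete lattice, and let $\mathcal{D}(L)$ be the poset of all nonempty compact saturated subsets of the Scott space $(L,\sigma(L))$, ordered by reverse inclusion ($K_1\le K_2$ iff $K_1\supseteq K_2$). If the Scott space $(L,\sigma(L))$ is non-sober, then the Scott space $(\mathcal{D}(L),\sigma(\mathcal{D}(L)))$ is non-sober.
   Context: For a poset $P$, a subset $U\subseteq P$ is Scott open if (i) $U$ is an upper set, i.e. $U={\uparrow}U=\{x\in P: y\le x\text{ for some }y\in U\}$, and (ii) for every (nonempty) directed subset $D\subseteq P$ whose supremum $\bigvee D$ exists, $\bigvee D\in U$ implies $D\cap U\neq\emptyset$. The Scott open sets form the Scott topology $\sigma(P)$, and $(P,\sigma(P))$ is the Scott space of $P$. A subset of a topological space is saturated if it equals the intersection of all open sets containing it. Compact means every open cover has a finite subcover (no Hausdorff condition). A nonempty subset $A$ of a space $X$ is irreducible if for any closed subsets $F_1,F_2$ of $X$, $A\subseteq F_1\cup F_2$ implies $A\subseteq F_1$ or $A\subseteq F_2$. A space $X$ is sober if every irreducible closed subset of $X$ is the closure of a unique singleton. *)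

theory Defs
  imports "HOL-Analysis.Analysis"
begin

text \<open>
  A poset is given by its carrier \<open>P\<close> and its order \<open>le\<close>, so that the same notion of Scott
  topology applies to a complete lattice (carrier \<open>UNIV\<close>) and to a family of sets ordered by
  reverse inclusion. The order is only meant to be used on \<open>P\<close>.
\<close>

definition up_closure :: "'a set \<Rightarrow> ('a \<Rightarrow> 'a \<Rightarrow> bool) \<Rightarrow> 'a set \<Rightarrow> 'a set" where
  "up_closure P le U = {x \<in> P. \<exists>y\<in>U. le y x}"

definition directed_in :: "'a set \<Rightarrow> ('a \<Rightarrow> 'a \<Rightarrow> bool) \<Rightarrow> 'a set \<Rightarrow> bool" where
  "directed_in P le D \<longleftrightarrow>
     D \<subseteq> P \<and> D \<noteq> {} \<and> (\<forall>x\<in>D. \<forall>y\<in>D. \<exists>z\<in>D. le x z \<and> le y z)"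

definition is_sup_in :: "'a set \<Rightarrow> ('a \<Rightarrow> 'a \<Rightarrow> bool) \<Rightarrow> 'a set \<Rightarrow> 'a \<Rightarrow> bool" where
  "is_sup_in P le D s \<longleftrightarrow>
     s \<in> P \<and> (\<forall>x\<in>D. le x s) \<and> (\<forall>u\<in>P. (\<forall>x\<in>D. le x u) \<longrightarrow> le s u)"

definition scott_open :: "'a set \<Rightarrow> ('a \<Rightarrow> 'a \<Rightarrow> bool) \<Rightarrow> 'a set \<Rightarrow> bool" where
  "scott_open P le U \<longleftrightarrow>
     U \<subseteq> P \<and> U = up_closure P le U \<and>
     (\<forall>D s. directed_in P le D \<and> is_sup_in P le D s \<and> s \<in> U \<longrightarrow> D \<inter> U \<noteq> {})"

definition scott_topology :: "'a set \<Rightarrow> ('a \<Rightarrow> 'a \<Rightarrow> bool) \<Rightarrow> 'a topology" where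
  "scott_topology P le = topology (scott_open P le)"

text \<open>
  The requirement \<open>S \<subseteq> topspace X\<close> excludes the case of an empty intersection,
  which is \<open>UNIV\<close> rather than \<open>topspace X\<close>.
\<close>

definition saturated_in :: "'a topology \<Rightarrow> 'a set \<Rightarrow> bool" where
  "saturated_in X S \<longleftrightarrow> S \<subseteq> topspace X \<and> S = \<Inter>{U. openin X U \<and> S \<subseteq> U}"

definition irreducible_in :: "'a topology \<Rightarrow> 'a set \<Rightarrow> bool" where
  "irreducible_in X A \<longleftrightarrow>
     A \<subseteq> topspace X \<and> A \<noteq> {} \<and>
     (\<forall>F1 F2. closedin X F1 \<and> closedin X F2 \<and> A \<subseteq> F1 \<union> F2 \<longrightarrow> A \<subseteq> F1 \<or> A \<subseteq> F2)"

definition sober_space :: "'a topology \<Rightarrow> bool" where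
  "sober_space X \<longleftrightarrow>
     (\<forall>A. closedin X A \<and> irreducible_in X A \<longrightarrow>
        (\<exists>!x. x \<in> topspace X \<and> A = X closure_of {x}))"

definition compact_saturated_sets :: "'a topology \<Rightarrow> 'a set set" where
  "compact_saturated_sets X = {K. K \<noteq> {} \<and> compactin X K \<and> saturated_in X K}"

definition lattice_scott :: "'a::complete_lattice topology" where
  "lattice_scott = scott_topology UNIV (\<le>)"

definition smyth_scott :: "'a::complete_lattice set topology" where
  "smyth_scott =
     scott_topology (compact_saturated_sets (lattice_scott :: 'a topology)) (\<lambda>K1 K2. K1 \<supseteq> K2)"

lemma scott_open_iff:
  assumes "reflp_on P le"
  shows "scott_open P le U \<longleftrightarrow>
     U \<subseteq> P \<and> (\<forall>y\<in>U. \<forall>x\<in>P. le y x \<longrightarrow> x \<in> U) \<and>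
     (\<forall>D s. directed_in P le D \<and> is_sup_in P le D s \<and> s \<in> U \<longrightarrow> D \<inter> U \<noteq> {})"
proof -
  have "U = up_closure P le U \<longleftrightarrow> (\<forall>y\<in>U. \<forall>x\<in>P. le y x \<longrightarrow> x \<in> U)" if U: "U \<subseteq> P"
  proof -
    have "U \<subseteq> up_closure P le U"
      using assms U by (auto simp: up_closure_def reflp_on_def)
    moreover have "up_closure P le U \<subseteq> U \<longleftrightarrow> (\<forall>y\<in>U. \<forall>x\<in>P. le y x \<longrightarrow> x \<in> U)"
      by (auto simp: up_closure_def)
    ultimately show ?thesis by (metis subset_antisym subset_refl)
  qed
  then show ?thesis
    unfolding scott_open_def by (intro conj_cong refl)
qed

lemma istopology_scott_open:
  assumes "reflp_on P le"
  shows "istopology (scott_open P le)"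
  unfolding istopology_def
proof (intro conjI allI impI)
  fix U V assume "scott_open P le U" "scott_open P le V"
  note U = this(1)[unfolded scott_open_iff[OF assms]] and V = this(2)[unfolded scott_open_iff[OF assms]]
  have "D \<inter> (U \<inter> V) \<noteq> {}"
    if D: "directed_in P le D" and s: "is_sup_in P le D s" "s \<in> U \<inter> V" for D s
  proof -
    have "D \<inter> U \<noteq> {}" using U D s by blast
    moreover have "D \<inter> V \<noteq> {}" using V D s by blast
    ultimately obtain x y where xy: "x \<in> D" "x \<in> U" "y \<in> D" "y \<in> V" by auto
    then obtain z where z: "z \<in> D" "z \<in> P" "le x z" "le y z"
      using D unfolding directed_in_def by (meson subsetD)
    have "z \<in> U" using U xy z by blast
    moreover have "z \<in> V" using V xy z by blast
    ultimately show ?thesis using z by auto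
  qed
  moreover have "U \<inter> V \<subseteq> P" using U by blast
  moreover have "\<forall>y\<in>U \<inter> V. \<forall>x\<in>P. le y x \<longrightarrow> x \<in> U \<inter> V" using U V by blast
  ultimately show "scott_open P le (U \<inter> V)"
    unfolding scott_open_iff[OF assms] by blast
next
  fix \<K> assume "\<forall>K\<in>\<K>. scott_open P le K"
  then have *: "K \<subseteq> P \<and> (\<forall>y\<in>K. \<forall>x\<in>P. le y x \<longrightarrow> x \<in> K) \<and>
      (\<forall>D s. directed_in P le D \<and> is_sup_in P le D s \<and> s \<in> K \<longrightarrow> D \<inter> K \<noteq> {})"
    if "K \<in> \<K>" for K
    using that scott_open_iff[OF assms] by metis
  have K: "K \<subseteq> P" "\<And>x y. y \<in> K \<Longrightarrow> x \<in> P \<Longrightarrow> le y x \<Longrightarrow> x \<in> K"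
      "\<And>D s. directed_in P le D \<Longrightarrow> is_sup_in P le D s \<Longrightarrow> s \<in> K \<Longrightarrow> D \<inter> K \<noteq> {}"
    if "K \<in> \<K>" for K
    using *[OF that] by blast+
  show "scott_open P le (\<Union>\<K>)"
    unfolding scott_open_iff[OF assms]
  proof (intro conjI allI impI ballI)
    show "\<Union>\<K> \<subseteq> P" using K(1) by (rule Sup_least)
    show "x \<in> \<Union>\<K>" if "y \<in> \<Union>\<K>" "x \<in> P" "le y x" for x y
      using that K(2) by (meson Union_iff)
    show "D \<inter> \<Union>\<K> \<noteq> {}" if D: "directed_in P le D \<and> is_sup_in P le D s \<and> s \<in> \<Union>\<K>" for D s
    proof -
      obtain K where "K \<in> \<K>" "s \<in> K" using D by auto
      then have "D \<inter> K \<noteq> {}" using D K(3) by blast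
      then show ?thesis using \<open>K \<in> \<K>\<close> by auto
    qed
  qed
qed

lemma openin_scott_topology:
  "reflp_on P le \<Longrightarrow> openin (scott_topology P le) U \<longleftrightarrow> scott_open P le U"
  unfolding scott_topology_def by (simp add: istopology_scott_open)

lemma topspace_scott_topology:
  assumes "reflp_on P le"
  shows "topspace (scott_topology P le) = P"
proof -
  have "scott_open P le P"
    unfolding scott_open_iff[OF assms] directed_in_def by auto
  then show ?thesis
    unfolding topspace_def openin_scott_topology[OF assms] scott_open_iff[OF assms] by auto
qed

lemma openin_lattice_scott: "openin lattice_scott U \<longleftrightarrow> scott_open UNIV (\<le>) U"
  unfolding lattice_scott_def by (rule openin_scott_topology) (simp add: reflp_on_def)

lemma topspace_lattice_scott: "topspace lattice_scott = UNIV"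
  unfolding lattice_scott_def by (rule topspace_scott_topology) (simp add: reflp_on_def)

lemma openin_smyth_scott:
  "openin smyth_scott \<U> \<longleftrightarrow>
     scott_open (compact_saturated_sets lattice_scott) (\<lambda>K1 K2. K1 \<supseteq> K2) \<U>"
  unfolding smyth_scott_def by (rule openin_scott_topology) (simp add: reflp_on_def)

lemma topspace_smyth_scott: "topspace smyth_scott = compact_saturated_sets lattice_scott"
  unfolding smyth_scott_def by (rule topspace_scott_topology) (simp add: reflp_on_def)

lemma is_sup_in_UNIV_iff: "is_sup_in UNIV (\<le>) D s \<longleftrightarrow> s = Sup (D :: 'a::complete_lattice set)"
proof
  assume "is_sup_in UNIV (\<le>) D s"
  then show "s = Sup D"
    unfolding is_sup_in_def by (intro antisym Sup_least) (auto intro: Sup_upper)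
next
  assume "s = Sup D"
  then show "is_sup_in UNIV (\<le>) D s"
    by (simp add: is_sup_in_def Sup_upper Sup_least)
qed

end

theory Submission
  imports Defs
begin

text \<open>
  The Scott space of a complete lattice is well-filtered (Xi and Lawson). Hence directed suprema
  of compact saturated sets are intersections, and for a Scott closed set \<open>A\<close> the family of all
  compact saturated sets meeting \<open>A\<close> is Scott closed. If \<open>A\<close> is irreducible, so is the closure
  of \<open>{\<up>a | a \<in> A}\<close>. When the space of compact saturated sets is sober, this closure has a greatest element \<open>K\<close>; then
  \<open>K\<close> consists of upper bounds of \<open>A\<close> and meets \<open>A\<close>, so \<open>A\<close> has a greatest element.
\<close>

section \<open>Closed sets and point closures in Scott topologies\<close>

text \<open>A directed set misses \<open>P - C\<close> exactly when it lies in \<open>C\<close>, so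
  complementation turns inaccessibility by directed suprema into closure under them.\<close>

lemma closedin_scott_topology:
  assumes "reflp_on P le"
  shows "closedin (scott_topology P le) C \<longleftrightarrow>
     C \<subseteq> P \<and> (\<forall>y\<in>C. \<forall>x\<in>P. le x y \<longrightarrow> x \<in> C) \<and>
     (\<forall>D s. directed_in P le D \<and> is_sup_in P le D s \<and> D \<subseteq> C \<longrightarrow> s \<in> C)"
proof -
  have "D \<inter> (P - C) = {} \<longleftrightarrow> D \<subseteq> C" if "directed_in P le D" for D
    using that unfolding directed_in_def by blast
  moreover have "s \<in> P" if "is_sup_in P le D s" for D s
    using that unfolding is_sup_in_def by blast
  ultimately have "(\<forall>D s. directed_in P le D \<and> is_sup_in P le D s \<and> s \<in> P - C \<longrightarrow> D \<inter> (P - C) \<noteq> {})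
      \<longleftrightarrow> (\<forall>D s. directed_in P le D \<and> is_sup_in P le D s \<and> D \<subseteq> C \<longrightarrow> s \<in> C)"
    by (metis DiffD2 DiffI)
  then show ?thesis
    unfolding closedin_def topspace_scott_topology[OF assms] openin_scott_topology[OF assms]
      scott_open_iff[OF assms]
    by blast
qed

text \<open>Transitivity makes the principal ideal of \<open>x\<close> a lower set, and leastness of
  suprema closes it under directed ones; any closed set containing \<open>x\<close> is lower and so
  includes it.\<close>

lemma closure_of_singleton_scott:
  assumes refl: "reflp_on P le" and trans: "transp_on P le" and x: "x \<in> P"
  shows "scott_topology P le closure_of {x} = {y \<in> P. le y x}"
proof (rule closure_of_unique)
  show "{x} \<subseteq> {y \<in> P. le y x}"
    using refl x by (auto dest: reflp_onD)
  show "closedin (scott_topology P le) {y \<in> P. le y x}"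
    unfolding closedin_scott_topology[OF refl] is_sup_in_def
    using x by (auto dest: transp_onD[OF trans])
  show "{y \<in> P. le y x} \<subseteq> T" if "{x} \<subseteq> T" "closedin (scott_topology P le) T" for T
    using that unfolding closedin_scott_topology[OF refl] by blast
qed

lemma closure_of_singleton_lattice_scott:
  "lattice_scott closure_of {x} = {..x::'a::complete_lattice}"
  unfolding lattice_scott_def
  by (subst closure_of_singleton_scott) (auto simp: reflp_on_def transp_on_def)

lemma closure_of_singleton_smyth_scott:
  assumes "K \<in> compact_saturated_sets lattice_scott"
  shows "smyth_scott closure_of {K} = {K' \<in> compact_saturated_sets lattice_scott. K \<subseteq> K'}"
  unfolding smyth_scott_def using assms
  by (subst closure_of_singleton_scott) (auto simp: reflp_on_def transp_on_def)

lemma closedin_smyth_scott: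
  "closedin smyth_scott \<C> \<longleftrightarrow>
     \<C> \<subseteq> compact_saturated_sets lattice_scott \<and>
     (\<forall>K\<in>\<C>. \<forall>K'\<in>compact_saturated_sets lattice_scott. K \<subseteq> K' \<longrightarrow> K' \<in> \<C>) \<and>
     (\<forall>\<D> s. directed_in (compact_saturated_sets lattice_scott) (\<supseteq>) \<D> \<and>
       is_sup_in (compact_saturated_sets lattice_scott) (\<supseteq>) \<D> s \<and> \<D> \<subseteq> \<C> \<longrightarrow> s \<in> \<C>)"
  unfolding smyth_scott_def by (subst closedin_scott_topology) (auto simp: reflp_on_def)

section \<open>Open and saturated sets in a complete lattice\<close>

lemma lattice_scott_open_iff:
  fixes U :: "'a::complete_lattice set"
  shows "openin lattice_scott U \<longleftrightarrow>
    (\<forall>y\<in>U. \<forall>x\<ge>y. x \<in> U) \<and>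
    (\<forall>D. directed_in UNIV (\<le>) D \<and> Sup D \<in> U \<longrightarrow> D \<inter> U \<noteq> {})"
  unfolding openin_lattice_scott
  by (subst scott_open_iff) (auto simp: reflp_on_def is_sup_in_UNIV_iff)

lemma openin_lattice_scott_not_le: "openin lattice_scott {x. \<not> x \<le> (a::'a::complete_lattice)}"
  unfolding lattice_scott_open_iff directed_in_def
  by (auto simp: Sup_le_iff dest: order_trans)

text \<open>Intersections of open sets are upper. Conversely, if \<open>K\<close> is upper and
  \<open>x\<close> is not in \<open>K\<close>, no point of \<open>K\<close> lies below
  \<open>x\<close>, so the open complement of \<open>{..x}\<close> separates \<open>K\<close> from
  \<open>x\<close>.\<close>

lemma saturated_in_lattice_scott_iff:
  fixes K :: "'a::complete_lattice set"
  shows "saturated_in lattice_scott K \<longleftrightarrow> (\<forall>x\<in>K. \<forall>y\<ge>x. y \<in> K)"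
proof
  assume "saturated_in lattice_scott K"
  then have K: "K = \<Inter>{U. openin lattice_scott U \<and> K \<subseteq> U}"
    unfolding saturated_in_def by simp
  have "y \<in> U" if "x \<in> K" "x \<le> y" "openin lattice_scott U" "K \<subseteq> U" for x y U
    using that unfolding lattice_scott_open_iff by blast
  then show "\<forall>x\<in>K. \<forall>y\<ge>x. y \<in> K"
    by (subst (2) K) blast
next
  assume K: "\<forall>x\<in>K. \<forall>y\<ge>x. y \<in> K"
  have "x \<in> K" if "\<And>U. openin lattice_scott U \<Longrightarrow> K \<subseteq> U \<Longrightarrow> x \<in> U" for x
    using that[OF openin_lattice_scott_not_le[of x]] K by blast
  then show "saturated_in lattice_scott K"
    unfolding saturated_in_def topspace_lattice_scott by blast
qed

lemma compact_saturated_upper: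
  "K \<in> compact_saturated_sets lattice_scott \<Longrightarrow> x \<in> K \<Longrightarrow> x \<le> y \<Longrightarrow> y \<in> K"
  unfolding compact_saturated_sets_def saturated_in_lattice_scott_iff by blast

text \<open>A member of an open cover that contains \<open>x\<close> is an upper set, so it alone
  covers \<open>{x..}\<close>.\<close>

lemma atLeast_compact_saturated:
  "{x..} \<in> compact_saturated_sets (lattice_scott :: 'a::complete_lattice topology)"
proof -
  have "\<exists>\<F>. finite \<F> \<and> \<F> \<subseteq> \<U> \<and> {x..} \<subseteq> \<Union>\<F>"
    if \<U>: "\<forall>U\<in>\<U>. openin lattice_scott U" "{x..} \<subseteq> \<Union>\<U>" for \<U>
  proof -
    obtain U where "U \<in> \<U>" "x \<in> U"
      using \<U>(2) by auto
    then have "{x..} \<subseteq> \<Union>{U}"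
      using \<U>(1) unfolding lattice_scott_open_iff by auto
    then show ?thesis
      using \<open>U \<in> \<U>\<close> by (intro exI[of _ "{U}"]) auto
  qed
  then show ?thesis
    by (auto simp: compact_saturated_sets_def compactin_def topspace_lattice_scott
        saturated_in_lattice_scott_iff)
qed

section \<open>Well-filteredness\<close>

lemma compactin_directed_cover:
  assumes K: "compactin X K" and \<U>: "\<And>U. U \<in> \<U> \<Longrightarrow> openin X U" "K \<subseteq> \<Union>\<U>" "\<U> \<noteq> {}"
    and dir: "\<And>U V. U \<in> \<U> \<Longrightarrow> V \<in> \<U> \<Longrightarrow> \<exists>W\<in>\<U>. U \<union> V \<subseteq> W"
  shows "\<exists>U\<in>\<U>. K \<subseteq> U"
proof -
  obtain \<F> where \<F>: "finite \<F>" "\<F> \<subseteq> \<U>" "K \<subseteq> \<Union>\<F>"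
    using K \<U> unfolding compactin_def by meson
  from \<F>(1,2) have "\<exists>U\<in>\<U>. \<Union>\<F> \<subseteq> U"
  proof induction
    case empty
    then show ?case using \<U>(3) by auto
  next
    case (insert U \<F>)
    then obtain V where "V \<in> \<U>" "\<Union>\<F> \<subseteq> V" by auto
    moreover obtain W where "W \<in> \<U>" "U \<union> V \<subseteq> W"
      using dir[of U V] insert.prems \<open>V \<in> \<U>\<close> by auto
    ultimately show ?case by (intro bexI[of _ W]) auto
  qed
  then show ?thesis using \<F>(3) by (meson subset_trans)
qed

text \<open>Joining with a fixed element preserves nonempty directed suprema, so \<open>sup\<close>
  is continuous in each variable separately. Compactness of \<open>K\<close> replaces joint
  continuity: for directed \<open>D\<close> with supremum in the set, the slices
  \<open>{y. sup d y \<in> U}\<close> with \<open>d \<in> D\<close> form a directed open cover of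
  \<open>K\<close>, and one of them already includes \<open>K\<close>.\<close>

lemma openin_lattice_scott_sup:
  fixes U :: "'a::complete_lattice set"
  assumes U: "openin lattice_scott U" and K: "compactin lattice_scott K"
  shows "openin lattice_scott {x. \<forall>y\<in>K. sup x y \<in> U}"
proof -
  have upper: "z \<in> U" if "y \<in> U" "y \<le> z" for y z
    using that U unfolding lattice_scott_open_iff by blast
  have meets: "D \<inter> U \<noteq> {}" if "directed_in UNIV (\<le>) D" "Sup D \<in> U" for D
    using that U unfolding lattice_scott_open_iff by blast
  have sup_dir: "directed_in UNIV (\<le>) ((\<lambda>d. sup d y) ` D)"
    if "directed_in UNIV (\<le>) D" for y :: 'a and D
    using that unfolding directed_in_def
    by (auto simp: image_iff) (meson le_supI1 sup_ge2)
  \<comment> \<open>For empty \<open>D\<close> the left side would be \<open>bot\<close> and the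
    right side \<open>y\<close>.\<close>
  have Sup_sup: "Sup ((\<lambda>d. sup d y) ` D) = sup (Sup D) y" if "D \<noteq> {}" for y :: 'a and D
    using that
    by (intro antisym SUP_least sup_least Sup_least)
      (auto intro: Sup_upper SUP_upper2 le_supI1)
  have slice: "openin lattice_scott {y. sup d y \<in> U}" for d
    unfolding lattice_scott_open_iff
  proof (intro conjI ballI allI impI)
    show "z \<in> {y. sup d y \<in> U}" if "y \<in> {y. sup d y \<in> U}" "y \<le> z" for y z
      using that upper sup_mono[OF order_refl, of y z d] by blast
    fix D :: "'a set" assume D: "directed_in UNIV (\<le>) D \<and> Sup D \<in> {y. sup d y \<in> U}"
    then have "D \<noteq> {}" by (simp add: directed_in_def)
    with D show "D \<inter> {y. sup d y \<in> U} \<noteq> {}"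
      using meets[OF sup_dir[of D d]] Sup_sup[of D d] by (auto simp: sup_commute)
  qed
  show ?thesis
    unfolding lattice_scott_open_iff
  proof (intro conjI ballI allI impI)
    show "z \<in> {x. \<forall>y\<in>K. sup x y \<in> U}" if "x \<in> {x. \<forall>y\<in>K. sup x y \<in> U}" "x \<le> z" for x z
      using that upper sup_mono[OF _ order_refl, of x z] by blast
    fix D :: "'a set" assume D: "directed_in UNIV (\<le>) D \<and> Sup D \<in> {x. \<forall>y\<in>K. sup x y \<in> U}"
    then have "D \<noteq> {}" by (simp add: directed_in_def)
    have "\<exists>V\<in>(\<lambda>d. {y. sup d y \<in> U}) ` D. K \<subseteq> V"
    proof (rule compactin_directed_cover[OF K])
      show "K \<subseteq> (\<Union>d\<in>D. {y. sup d y \<in> U})"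
      proof
        fix y assume "y \<in> K"
        then show "y \<in> (\<Union>d\<in>D. {y. sup d y \<in> U})"
          using D \<open>D \<noteq> {}\<close> meets[OF sup_dir[of D y]] Sup_sup[of D y] by auto
      qed
      show "\<exists>W\<in>(\<lambda>d. {y. sup d y \<in> U}) ` D. V \<union> V' \<subseteq> W"
        if V: "V \<in> (\<lambda>d. {y. sup d y \<in> U}) ` D" "V' \<in> (\<lambda>d. {y. sup d y \<in> U}) ` D" for V V'
      proof -
        obtain d d' where d: "d \<in> D" "V = {y. sup d y \<in> U}" "d' \<in> D" "V' = {y. sup d' y \<in> U}"
          using V by auto
        obtain e where e: "e \<in> D" "d \<le> e" "d' \<le> e"
          using D d unfolding directed_in_def by blast
        have "V \<union> V' \<subseteq> {y. sup e y \<in> U}"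
          using d e upper by (auto intro: sup_mono)
        then show ?thesis using e by blast
      qed
    qed (use slice \<open>D \<noteq> {}\<close> in auto)
    then show "D \<inter> {x. \<forall>y\<in>K. sup x y \<in> U} \<noteq> {}" by auto
  qed
qed

text \<open>Zorn's lemma applies to the complement of \<open>U\<close>: a nonempty chain is
  directed, so its supremum cannot enter the Scott open set \<open>U\<close>.\<close>

lemma lattice_scott_maximal_notin_open:
  fixes U :: "'a::complete_lattice set"
  assumes U: "openin lattice_scott U" and "U \<noteq> UNIV"
  obtains m where "m \<notin> U" "\<And>x. x \<notin> U \<Longrightarrow> m \<le> x \<Longrightarrow> x = m"
proof -
  have "\<exists>m\<in>- U. \<forall>x\<in>- U. m \<le> x \<longrightarrow> x = m"
  proof (rule predicate_Zorn)
    show "partial_order_on (- U) (relation_of (\<le>) (- U))"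
      by (rule partial_order_on_relation_ofI) auto
    fix C assume C: "C \<in> Chains (relation_of (\<le>) (- U))"
    then have sub: "C \<subseteq> - U" and chain: "\<And>x y. x \<in> C \<Longrightarrow> y \<in> C \<Longrightarrow> x \<le> y \<or> y \<le> x"
      unfolding Chains_def relation_of_def by auto
    show "\<exists>u\<in>- U. \<forall>x\<in>C. x \<le> u"
    \<comment> \<open>The empty chain is not directed; any point outside \<open>U\<close> bounds
      it.\<close>
    proof (cases "C = {}")
      case True
      then show ?thesis using \<open>U \<noteq> UNIV\<close> by auto
    next
      case False
      then have "directed_in UNIV (\<le>) C"
        unfolding directed_in_def using chain by blast
      then have "Sup C \<notin> U"
        using U sub unfolding lattice_scott_open_iff by blast
      then show ?thesis by (auto intro: Sup_upper)
    qed
  qed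
  then show ?thesis using that by blast
qed

text \<open>
  A maximal open \<open>M \<supseteq> U\<close> containing no member of the family satisfies
  \<open>{x. \<forall>y\<in>K. sup x y \<in> M} = M\<close> for each member \<open>K\<close>, by idempotence of \<open>sup\<close>. So a maximal
  point of the complement of \<open>M\<close> lies above some point of each \<open>K\<close>.
\<close>
lemma lattice_scott_well_filtered:
  fixes U :: "'a::complete_lattice set"
  assumes \<D>: "directed_in (compact_saturated_sets lattice_scott) (\<supseteq>) \<D>"
    and U: "openin lattice_scott U" "\<Inter>\<D> \<subseteq> U"
  shows "\<exists>K\<in>\<D>. K \<subseteq> U"
proof (rule ccontr)
  assume none: "\<not> (\<exists>K\<in>\<D>. K \<subseteq> U)"
  have cs: "K \<in> compact_saturated_sets lattice_scott" if "K \<in> \<D>" for K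
    using \<D> that unfolding directed_in_def by blast
  then have cpt: "compactin lattice_scott K" if "K \<in> \<D>" for K
    using that unfolding compact_saturated_sets_def by blast
  define \<A> where "\<A> = {V. openin lattice_scott V \<and> U \<subseteq> V \<and> (\<forall>K\<in>\<D>. \<not> K \<subseteq> V)}"
  have "\<exists>M\<in>\<A>. \<forall>V\<in>\<A>. M \<subseteq> V \<longrightarrow> V = M"
  proof (rule subset_Zorn_nonempty)
    show "\<A> \<noteq> {}" using none U(1) unfolding \<A>_def by blast
    fix \<C> assume \<C>: "\<C> \<noteq> {}" "subset.chain \<A> \<C>"
    then have sub: "\<C> \<subseteq> \<A>" and lin: "\<And>V W. V \<in> \<C> \<Longrightarrow> W \<in> \<C> \<Longrightarrow> V \<subseteq> W \<or> W \<subseteq> V"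
      unfolding subset_chain_def by auto
    \<comment> \<open>The chain is a directed family of open sets, so a compact \<open>K\<close>
      inside its union would lie in a single member, against the choice of
      \<open>\<A>\<close>.\<close>
    have "\<not> K \<subseteq> \<Union>\<C>" if "K \<in> \<D>" for K
    proof
      assume "K \<subseteq> \<Union>\<C>"
      moreover have "openin lattice_scott V" if "V \<in> \<C>" for V
        using sub that unfolding \<A>_def by blast
      moreover have "\<exists>X\<in>\<C>. V \<union> W \<subseteq> X" if "V \<in> \<C>" "W \<in> \<C>" for V W
        using lin[OF that] that by blast
      ultimately have "\<exists>V\<in>\<C>. K \<subseteq> V"
        using compactin_directed_cover[OF cpt[OF that], of \<C>] \<C>(1) by blast
      then show False using sub that unfolding \<A>_def by blast
    qed
    then show "\<Union>\<C> \<in> \<A>"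
      using sub \<C>(1) unfolding \<A>_def by (auto intro!: openin_Union)
  qed
  then obtain M where M: "M \<in> \<A>" and max: "\<And>V. V \<in> \<A> \<Longrightarrow> M \<subseteq> V \<Longrightarrow> V = M"
    by blast
  have openM: "openin lattice_scott M" and "U \<subseteq> M" and M_none: "\<And>K. K \<in> \<D> \<Longrightarrow> \<not> K \<subseteq> M"
    using M unfolding \<A>_def by auto
  have stable: "{x. \<forall>y\<in>K. sup x y \<in> M} = M" if "K \<in> \<D>" for K
  proof (rule max)
    show le: "M \<subseteq> {x. \<forall>y\<in>K. sup x y \<in> M}"
      using openM unfolding lattice_scott_open_iff by auto
    have "\<not> K' \<subseteq> {x. \<forall>y\<in>K. sup x y \<in> M}" if "K' \<in> \<D>" for K'
    proof
      assume K': "K' \<subseteq> {x. \<forall>y\<in>K. sup x y \<in> M}"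
      \<comment> \<open>A point \<open>x\<close> of this common refinement lies in both
        \<open>K'\<close> and \<open>K\<close>, so it may serve as both arguments of
        \<open>sup\<close>.\<close>
      obtain K'' where "K'' \<in> \<D>" "K'' \<subseteq> K" "K'' \<subseteq> K'"
        using \<D> \<open>K \<in> \<D>\<close> \<open>K' \<in> \<D>\<close> unfolding directed_in_def by blast
      have "x \<in> M" if "x \<in> K''" for x
      proof -
        have "sup x x \<in> M"
          using that K' \<open>K'' \<subseteq> K\<close> \<open>K'' \<subseteq> K'\<close> by blast
        then show ?thesis by simp
      qed
      then show False using M_none \<open>K'' \<in> \<D>\<close> by blast
    qed
    then show "{x. \<forall>y\<in>K. sup x y \<in> M} \<in> \<A>"
      using openin_lattice_scott_sup[OF openM cpt[OF that]] le \<open>U \<subseteq> M\<close> unfolding \<A>_def by auto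
  qed
  have "\<D> \<noteq> {}" using \<D> unfolding directed_in_def by blast
  then have "M \<noteq> UNIV" using M_none by blast
  then obtain m where m: "m \<notin> M" "\<And>x. x \<notin> M \<Longrightarrow> m \<le> x \<Longrightarrow> x = m"
    using lattice_scott_maximal_notin_open[OF openM] by metis
  have "m \<in> K" if "K \<in> \<D>" for K
  proof -
    obtain y where y: "y \<in> K" "sup m y \<notin> M"
      using stable[OF \<open>K \<in> \<D>\<close>] m(1) by blast
    then have "sup m y = m" using m(2) by simp
    then have "y \<le> m" by (metis sup_ge2)
    then show ?thesis using compact_saturated_upper[OF cs[OF that]] y(1) by blast
  qed
  then show False using U(2) \<open>U \<subseteq> M\<close> m(1) by blast
qed

section \<open>Directed suprema and closed families of compact saturated sets\<close>

text \<open>Well-filteredness is applied twice: with the empty open set it gives nonemptiness, and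
  with the union of an open cover it reduces compactness of the intersection to that of one
  member.\<close>

lemma directed_Inter_compact_saturated:
  fixes \<D> :: "'a::complete_lattice set set"
  assumes \<D>: "directed_in (compact_saturated_sets lattice_scott) (\<supseteq>) \<D>"
  shows "\<Inter>\<D> \<in> compact_saturated_sets lattice_scott"
proof -
  have cs: "K \<in> compact_saturated_sets lattice_scott" if "K \<in> \<D>" for K
    using \<D> that unfolding directed_in_def by blast
  then have K: "compactin lattice_scott K" "K \<noteq> {}" if "K \<in> \<D>" for K
    using that unfolding compact_saturated_sets_def by blast+
  have "\<Inter>\<D> \<noteq> {}"
    using lattice_scott_well_filtered[OF \<D>, of "{}"] K(2) by auto
  moreover have "saturated_in lattice_scott (\<Inter>\<D>)"
    unfolding saturated_in_lattice_scott_iff using compact_saturated_upper[OF cs] by blast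
  moreover have "compactin lattice_scott (\<Inter>\<D>)"
    unfolding compactin_def
  proof (intro conjI allI impI)
    fix \<U> :: "'a set set"
    assume \<U>: "(\<forall>V\<in>\<U>. openin lattice_scott V) \<and> \<Inter>\<D> \<subseteq> \<Union>\<U>"
    then obtain K' where "K' \<in> \<D>" "K' \<subseteq> \<Union>\<U>"
      using lattice_scott_well_filtered[OF \<D>, of "\<Union>\<U>"] by (auto intro: openin_Union)
    then obtain \<F> where "finite \<F>" "\<F> \<subseteq> \<U>" "K' \<subseteq> \<Union>\<F>"
      using K(1)[of K'] \<U> unfolding compactin_def by meson
    then show "\<exists>\<F>. finite \<F> \<and> \<F> \<subseteq> \<U> \<and> \<Inter>\<D> \<subseteq> \<Union>\<F>"
      using \<open>K' \<in> \<D>\<close> by (intro exI[of _ \<F>]) auto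
  qed (simp add: topspace_lattice_scott)
  ultimately show ?thesis
    unfolding compact_saturated_sets_def by blast
qed

text \<open>If a directed supremum missed \<open>A\<close>, the intersection of the family would lie
  in the open complement of \<open>A\<close>, and by well-filteredness so would one of its
  members.\<close>

lemma closedin_smyth_scott_meets:
  fixes A :: "'a::complete_lattice set"
  assumes A: "closedin lattice_scott A"
  shows "closedin smyth_scott {K \<in> compact_saturated_sets lattice_scott. K \<inter> A \<noteq> {}}"
  unfolding closedin_smyth_scott
proof (intro conjI ballI allI impI)
  fix \<D> :: "'a set set" and s
  assume *: "directed_in (compact_saturated_sets lattice_scott) (\<supseteq>) \<D> \<and>
    is_sup_in (compact_saturated_sets lattice_scott) (\<supseteq>) \<D> s \<and>
    \<D> \<subseteq> {K \<in> compact_saturated_sets lattice_scott. K \<inter> A \<noteq> {}}"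
  \<comment> \<open>The intersection is itself an upper bound for reverse inclusion, so the least
    upper bound \<open>s\<close> includes it.\<close>
  then have s: "s \<in> compact_saturated_sets lattice_scott" "\<Inter>\<D> \<subseteq> s"
    using directed_Inter_compact_saturated[of \<D>] unfolding is_sup_in_def by blast+
  have "s \<inter> A \<noteq> {}"
  proof
    assume "s \<inter> A = {}"
    then have "\<Inter>\<D> \<subseteq> - A" using s by blast
    moreover have "openin lattice_scott (- A)"
      using A unfolding closedin_def topspace_lattice_scott by (simp add: Compl_eq_Diff_UNIV)
    ultimately show False
      using lattice_scott_well_filtered[of \<D> "- A"] * by blast
  qed
  then show "s \<in> {K \<in> compact_saturated_sets lattice_scott. K \<inter> A \<noteq> {}}" using s by blast
qed blast+

section \<open>Transporting irreducible sets along the principal filter map\<close>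

text \<open>The map is monotone for reverse inclusion and preserves directed suprema, so preimages
  of closed families are closed.\<close>

lemma continuous_map_atLeast:
  "continuous_map lattice_scott smyth_scott (\<lambda>x::'a::complete_lattice. {x..})"
  unfolding continuous_map_closedin
proof (intro conjI allI impI)
  show "(\<lambda>x::'a. {x..}) \<in> topspace lattice_scott \<rightarrow> topspace smyth_scott"
    using atLeast_compact_saturated by (auto simp: topspace_smyth_scott)
  fix \<C> :: "'a set set" assume \<C>: "closedin smyth_scott \<C>"
  have "closedin lattice_scott {x. {x..} \<in> \<C>}"
    unfolding lattice_scott_def
  proof (subst closedin_scott_topology; (intro conjI ballI allI impI)?)
    show "x \<in> {x. {x..} \<in> \<C>}" if "y \<in> {x. {x..} \<in> \<C>}" "x \<le> y" for x y
    proof -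
      have "{y..} \<subseteq> {x..}" using that(2) by auto
      then show ?thesis
        using that(1) \<C> atLeast_compact_saturated[of x] unfolding closedin_smyth_scott by blast
    qed
    fix D :: "'a set" and s
    assume D: "directed_in UNIV (\<le>) D \<and> is_sup_in UNIV (\<le>) D s \<and> D \<subseteq> {x. {x..} \<in> \<C>}"
    have "directed_in (compact_saturated_sets lattice_scott) (\<supseteq>) (atLeast ` D)"
      using D atLeast_compact_saturated unfolding directed_in_def by auto
    \<comment> \<open>A set included in every \<open>{d..}\<close> consists of upper bounds of
      \<open>D\<close>, hence lies in \<open>{s..}\<close>.\<close>
    moreover have "is_sup_in (compact_saturated_sets lattice_scott) (\<supseteq>) (atLeast ` D) {s..}"
      using D atLeast_compact_saturated
      by (auto simp: is_sup_in_def subset_eq)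
    moreover have "atLeast ` D \<subseteq> \<C>" using D by blast
    ultimately have "{s..} \<in> \<C>"
      using \<C> unfolding closedin_smyth_scott by blast
    then show "s \<in> {x. {x..} \<in> \<C>}" by simp
  qed (auto simp: reflp_on_def)
  then show "closedin lattice_scott {x \<in> topspace lattice_scott. {x..} \<in> \<C>}"
    by (simp add: topspace_lattice_scott)
qed

text \<open>Two closed sets covering the closure have closed preimages covering \<open>A\<close>;
  one preimage includes \<open>A\<close>, so the corresponding closed set includes the image and its
  closure.\<close>

lemma irreducible_in_closure_of_image:
  assumes f: "continuous_map X Y f" and A: "irreducible_in X A"
  shows "irreducible_in Y (Y closure_of (f ` A))"
  unfolding irreducible_in_def
proof (intro conjI allI impI)
  have "A \<subseteq> topspace X" "A \<noteq> {}" using A unfolding irreducible_in_def by blast+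
  then have sub: "f ` A \<subseteq> Y closure_of (f ` A)"
    using continuous_map_image_subset_topspace[OF f] by (intro closure_of_subset) auto
  then show "Y closure_of (f ` A) \<noteq> {}" using \<open>A \<noteq> {}\<close> by blast
  fix F G assume FG: "closedin Y F \<and> closedin Y G \<and> Y closure_of (f ` A) \<subseteq> F \<union> G"
  let ?pre = "\<lambda>C. {x \<in> topspace X. f x \<in> C}"
  have "closedin X (?pre F)" "closedin X (?pre G)"
    using FG f closedin_continuous_map_preimage by blast+
  moreover have "A \<subseteq> ?pre F \<union> ?pre G"
    using sub FG \<open>A \<subseteq> topspace X\<close> by blast
  ultimately have "A \<subseteq> ?pre F \<or> A \<subseteq> ?pre G"
    using A unfolding irreducible_in_def by blast
  then have "f ` A \<subseteq> F \<or> f ` A \<subseteq> G" by blast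
  then show "Y closure_of (f ` A) \<subseteq> F \<or> Y closure_of (f ` A) \<subseteq> G"
    using FG closure_of_minimal by metis
qed (rule closure_of_subset_topspace)

theorem theorem3:
  assumes "\<not> sober_space (lattice_scott :: 'a::complete_lattice topology)"
  shows "\<not> sober_space (smyth_scott :: 'a set topology)"
proof
  assume sober: "sober_space (smyth_scott :: 'a set topology)"
  have "\<exists>!x. x \<in> topspace lattice_scott \<and> A = lattice_scott closure_of {x}"
    if A: "closedin lattice_scott A" "irreducible_in lattice_scott A" for A :: "'a set"
  proof -
    let ?\<A> = "smyth_scott closure_of (atLeast ` A)"
    have "irreducible_in smyth_scott ?\<A>"
      using continuous_map_atLeast A(2) by (rule irreducible_in_closure_of_image)
    then have "\<exists>!K. K \<in> topspace smyth_scott \<and> ?\<A> = smyth_scott closure_of {K}"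
      using sober[unfolded sober_space_def, rule_format, of ?\<A>] by simp
    then obtain K where K: "K \<in> topspace smyth_scott" "?\<A> = smyth_scott closure_of {K}"
      by (elim ex1E conjE)
    then have K_cs: "K \<in> compact_saturated_sets lattice_scott"
      by (simp add: topspace_smyth_scott)
    have cl: "?\<A> = {K' \<in> compact_saturated_sets lattice_scott. K \<subseteq> K'}"
      using K(2) closure_of_singleton_smyth_scott[OF K_cs] by simp
    \<comment> \<open>Each \<open>{a..}\<close> meets \<open>A\<close> in \<open>a\<close>. The
      family on the right is closed, so it includes the whole closure \<open>?\<A>\<close>.\<close>
    have "atLeast ` A \<subseteq> {K \<in> compact_saturated_sets lattice_scott. K \<inter> A \<noteq> {}}"
      using atLeast_compact_saturated by fastforce
    then have "?\<A> \<subseteq> {K \<in> compact_saturated_sets lattice_scott. K \<inter> A \<noteq> {}}"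
      using closedin_smyth_scott_meets[OF A(1)] by (rule closure_of_minimal)
    \<comment> \<open>\<open>K\<close> belongs to its own point closure \<open>?\<A>\<close>, hence
      meets \<open>A\<close>. The common point becomes the greatest element of \<open>A\<close>,
      since \<open>K\<close>, and with it \<open>x\<close>, lies in every \<open>{a..}\<close> with
      \<open>a \<in> A\<close>.\<close>
    then obtain x where x: "x \<in> K" "x \<in> A"
      using cl K_cs by blast
    have "atLeast ` A \<subseteq> ?\<A>"
      using atLeast_compact_saturated by (intro closure_of_subset) (auto simp: topspace_smyth_scott)
    then have "a \<le> x" if "a \<in> A" for a
      using that x(1) cl by auto
    moreover have "{..x} \<subseteq> A"
      using closure_of_minimal[of "{x}" A lattice_scott] A(1) x(2)
      by (simp add: closure_of_singleton_lattice_scott)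
    ultimately have "A = {..x}" by auto
    \<comment> \<open>Uniqueness is antisymmetry: equal principal ideals have equal greatest
      elements.\<close>
    then show ?thesis
      by (auto simp: topspace_lattice_scott closure_of_singleton_lattice_scott)
  qed
  then have "sober_space (lattice_scott :: 'a topology)"
    unfolding sober_space_def by blast
  with assms show False by blast
qed

end
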